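(* Let $Q$ be a CC-loop and let $b,c\in Q$ be power-associative elements such that $c$ is a WIP element. Then the subloop $\langle b^2,c\rangle$ is a group.
   Context: A loop is a set $Q$ with a binary operation having a two-sided identity $1$ such that all equations $xu=y$ and $vx=y$ have unique solutions $u=x\backslash y$ and $v=y/x$. A loop $Q$ is conjugacy closed (a CC-loop) if there are functions $f,g:Q\times Q\to Q$ such that for all $x,y,z\in Q$: $x(yz)=f(x,y)(xz)$ and $(zy)x=(zx)g(x,y)$. $\langle S\rangle$ denotes the subloop generated by $S$. An element $a$ is power-associative if $\langle a\rangle$ is a group. An element $c$ is a WIP element if $c\cdot((xc)\backslash 1)=x\backslash 1$ for all $x\in Q$. *)

theory Defs
  imports "HOL-Algebra.Group"
begin

(* A loop is carried by the monoid record of HOL-Algebra, which by itself imposes no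
   associativity, so that "is a group" below is the library predicate group. *)

locale loop =
  fixes Q (structure)
  assumes m_closed [intro, simp]:
      "\<lbrakk>x \<in> carrier Q; y \<in> carrier Q\<rbrakk> \<Longrightarrow> x \<otimes> y \<in> carrier Q"
    and one_closed [intro, simp]: "\<one> \<in> carrier Q"
    and l_one [simp]: "x \<in> carrier Q \<Longrightarrow> \<one> \<otimes> x = x"
    and r_one [simp]: "x \<in> carrier Q \<Longrightarrow> x \<otimes> \<one> = x"
    and l_solve: "\<lbrakk>x \<in> carrier Q; y \<in> carrier Q\<rbrakk> \<Longrightarrow> \<exists>!u. u \<in> carrier Q \<and> x \<otimes> u = y"
    and r_solve: "\<lbrakk>x \<in> carrier Q; y \<in> carrier Q\<rbrakk> \<Longrightarrow> \<exists>!v. v \<in> carrier Q \<and> v \<otimes> x = y"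

(* ldiv Q x y is x\y and rdiv Q y x is y/x. *)

definition ldiv :: "('a, 'm) monoid_scheme \<Rightarrow> 'a \<Rightarrow> 'a \<Rightarrow> 'a" where
  "ldiv Q x y = (THE u. u \<in> carrier Q \<and> x \<otimes>\<^bsub>Q\<^esub> u = y)"

definition rdiv :: "('a, 'm) monoid_scheme \<Rightarrow> 'a \<Rightarrow> 'a \<Rightarrow> 'a" where
  "rdiv Q y x = (THE v. v \<in> carrier Q \<and> v \<otimes>\<^bsub>Q\<^esub> x = y)"

locale cc_loop = loop +
  assumes conj_closed:
    "\<exists>f g. f \<in> carrier Q \<rightarrow> carrier Q \<rightarrow> carrier Q \<and> g \<in> carrier Q \<rightarrow> carrier Q \<rightarrow> carrier Q \<and>
       (\<forall>x\<in>carrier Q. \<forall>y\<in>carrier Q. \<forall>z\<in>carrier Q.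
          x \<otimes> (y \<otimes> z) = f x y \<otimes> (x \<otimes> z) \<and>
          (z \<otimes> y) \<otimes> x = (z \<otimes> x) \<otimes> g x y)"

definition subloop :: "'a set \<Rightarrow> ('a, 'm) monoid_scheme \<Rightarrow> bool" where
  "subloop H Q \<longleftrightarrow> H \<subseteq> carrier Q \<and> \<one>\<^bsub>Q\<^esub> \<in> H \<and>
     (\<forall>x\<in>H. \<forall>y\<in>H. x \<otimes>\<^bsub>Q\<^esub> y \<in> H \<and> ldiv Q x y \<in> H \<and> rdiv Q y x \<in> H)"

definition subloop_generated :: "('a, 'm) monoid_scheme \<Rightarrow> 'a set \<Rightarrow> 'a set" where
  "subloop_generated Q S = \<Inter>{H. subloop H Q \<and> S \<subseteq> H}"

definition power_assoc_elem :: "('a, 'm) monoid_scheme \<Rightarrow> 'a \<Rightarrow> bool" where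
  "power_assoc_elem Q a \<longleftrightarrow> group (Q\<lparr>carrier := subloop_generated Q {a}\<rparr>)"

definition WIP_elem :: "('a, 'm) monoid_scheme \<Rightarrow> 'a \<Rightarrow> bool" where
  "WIP_elem Q c \<longleftrightarrow>
     (\<forall>x\<in>carrier Q. c \<otimes>\<^bsub>Q\<^esub> ldiv Q (x \<otimes>\<^bsub>Q\<^esub> c) \<one>\<^bsub>Q\<^esub> = ldiv Q x \<one>\<^bsub>Q\<^esub>)"

context loop
begin

lemma ldiv_closed [intro, simp]:
    "\<lbrakk>x \<in> carrier Q; y \<in> carrier Q\<rbrakk> \<Longrightarrow> ldiv Q x y \<in> carrier Q"
  and m_ldiv [simp]: "\<lbrakk>x \<in> carrier Q; y \<in> carrier Q\<rbrakk> \<Longrightarrow> x \<otimes> ldiv Q x y = y"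
  unfolding ldiv_def using theI'[OF l_solve] by auto

lemma rdiv_closed [intro, simp]:
    "\<lbrakk>x \<in> carrier Q; y \<in> carrier Q\<rbrakk> \<Longrightarrow> rdiv Q y x \<in> carrier Q"
  and rdiv_m [simp]: "\<lbrakk>x \<in> carrier Q; y \<in> carrier Q\<rbrakk> \<Longrightarrow> rdiv Q y x \<otimes> x = y"
  unfolding rdiv_def using theI'[OF r_solve] by auto

lemma subloop_carrier: "subloop (carrier Q) Q"
  by (auto simp: subloop_def)

lemma subloop_generated:
  assumes "S \<subseteq> carrier Q"
  shows "subloop (subloop_generated Q S) Q" and "S \<subseteq> subloop_generated Q S"
proof -
  have "subloop_generated Q S \<subseteq> carrier Q"
    using assms subloop_carrier by (auto simp: subloop_generated_def)
  then show "subloop (subloop_generated Q S) Q"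
    unfolding subloop_def by (auto simp: subloop_generated_def) (auto simp: subloop_def)
  show "S \<subseteq> subloop_generated Q S"
    by (auto simp: subloop_generated_def)
qed

end

end

theory Submission
  imports Defs
begin

text \<open>
  The left translations of a CC-loop are closed under conjugation, so every element of the left
  multiplication group that fixes the identity is an automorphism, and similarly on the right. As
  conjugation by $R_x$ normalizes the left multiplication group and vice versa, any $w$ and any such
  automorphism $f$ give a commutator of $f$ with a translation by $w$ lying in both groups, and the
  value of such an element at the identity is nuclear. This puts all associators into the centre
  $Z(N)$ of the nucleus $N$. Conjugating $R_v R_u = R_{u'} R_v$, where $v u' = u v$, by $L_x$ then
  shows that $u$ and $u'$ differ by a nuclear element, so that $Q/N$ is an abelian group (Basarab).

  Hence associators, written $x(yz) = (xy)z\cdot[x,y,z]$, form a totally symmetric function into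
  $Z(N)$ with $[x,y,zw] = [x,y,z]^w\,[x,y,w]$. Power-associativity gives $[b,b,b] = [c,c,c] = 1$ and
  the WIP condition is $[x,c,xc] = 1$. Taking $x = b$ and $x = bc$ yields $[b,b,c] = [b,c,c]$, of
  order dividing 2 and fixed by conjugation with $b$, which kills all associators of $b^2$ and $c$.
\<close>

section \<open>The group of bijections of a type\<close>

text \<open>
  Composition is written additively so that the type is an instance of \<^class>\<open>group_add\<close>, the
  only class of not necessarily commutative groups.
\<close>

typedef 'a bijection = "{f :: 'a \<Rightarrow> 'a. bij f}"
  morphisms app Bijection
  by (rule exI[of _ id]) simp

notation app (infixr "\<cdot>" 75)

lemma bij_app: "bij (app f)"
  using app by blast

lemma bijection_eqI: "(\<And>x. f \<cdot> x = g \<cdot> x) \<Longrightarrow> f = g"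
  using app_inject by blast

lemma app_inj_iff [simp]: "f \<cdot> x = f \<cdot> y \<longleftrightarrow> x = y"
  using bij_app by (metis bij_pointE)

instantiation bijection :: (type) group_add
begin

definition "0 = Bijection id"
definition "f + g = Bijection (app f \<circ> app g)"
definition "- f = Bijection (inv_into UNIV (app f))"
definition "f - g = f + - (g :: 'a bijection)"

instance proof
  fix f g h :: "'a bijection"
  show "f + g + h = f + (g + h)"
    by (simp add: plus_bijection_def Bijection_inverse bij_app bij_comp o_assoc)
  show "0 + f = f" "f + 0 = f"
    by (simp_all add: plus_bijection_def zero_bijection_def Bijection_inverse app_inverse)
  show "- f + f = 0"
    using bij_app[of f]
    by (simp add: plus_bijection_def zero_bijection_def uminus_bijection_def Bijection_inverse
        bij_imp_bij_inv bij_is_inj)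
  show "f + - g = f - g"
    by (simp add: minus_bijection_def)
qed

end

lemma app_zero [simp]: "0 \<cdot> x = x"
  by (simp add: zero_bijection_def Bijection_inverse)

lemma app_plus [simp]: "(f + g) \<cdot> x = f \<cdot> g \<cdot> x"
  by (simp add: plus_bijection_def Bijection_inverse bij_app bij_comp)

lemma app_minus_app [simp]: "- f \<cdot> f \<cdot> x = x" "f \<cdot> - f \<cdot> x = x"
  by (metis app_plus app_zero left_minus right_minus)+

lemma app_diff [simp]: "(f - g) \<cdot> x = f \<cdot> - g \<cdot> x"
  by (metis app_plus diff_conv_add_uminus)

text \<open>These rules turn differences into sums with negatives and reassociate to the right, so
  that equal group words become identical terms. The opposite rule
  \<open>add_uminus_conv_diff\<close> is deleted wherever they are used for simplification.\<close>

lemmas group_word = add.assoc diff_conv_add_uminus minus_add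

section \<open>Subgroups spanned by a set, and conjugation\<close>

inductive_set subgroup_span :: "'g::group_add set \<Rightarrow> 'g set" for S where
  base: "s \<in> S \<Longrightarrow> s \<in> subgroup_span S"
| zero: "0 \<in> subgroup_span S"
| add: "\<lbrakk>f \<in> subgroup_span S; g \<in> subgroup_span S\<rbrakk> \<Longrightarrow> f + g \<in> subgroup_span S"
| minus: "f \<in> subgroup_span S \<Longrightarrow> - f \<in> subgroup_span S"

lemma subgroup_span_diff:
  "\<lbrakk>f \<in> subgroup_span S; g \<in> subgroup_span S\<rbrakk> \<Longrightarrow> f - g \<in> subgroup_span S"
  using subgroup_span.add[of f S "- g"] subgroup_span.minus by fastforce

text \<open>Conjugation by \<open>a\<close> is a homomorphism, so the generators decide.\<close>

lemma subgroup_span_conjugate: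
  assumes "f \<in> subgroup_span S" and "\<And>s. s \<in> S \<Longrightarrow> a + s - a \<in> subgroup_span T"
  shows "a + f - a \<in> subgroup_span T"
  using assms(1)
proof induction
  case (add f g)
  have "(a + f - a) + (a + g - a) \<in> subgroup_span T"
    using add.IH by (rule subgroup_span.add)
  then show ?case by (simp add: group_word del: add_uminus_conv_diff)
next
  case (minus f)
  have "- (a + f - a) \<in> subgroup_span T"
    using minus.IH by (rule subgroup_span.minus)
  then show ?case by (simp add: group_word del: add_uminus_conv_diff)
qed (use assms(2) subgroup_span.zero in auto)

lemma subgroup_span_commute:
  assumes "f \<in> subgroup_span S" and "\<And>s. s \<in> S \<Longrightarrow> a + s = s + a"
  shows "a + f = f + a"
  using assms(1)
proof induction
  case (add f g)
  then show ?case by (metis add.assoc)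
next
  case (minus f)
  then have "- f + (a + f) - f = - f + (f + a) - f"
    by simp
  then show ?case by (simp add: group_word del: add_uminus_conv_diff)
qed (use assms(2) in auto)

text \<open>\<open>T\<close> need not be a subgroup; it will usually be a set of translations. Both
  directions of conjugation are assumed because the case of an inverse swaps them.\<close>

lemma subgroup_span_normalizes:
  assumes "f \<in> subgroup_span S"
    and "\<And>s t. \<lbrakk>s \<in> S; t \<in> T\<rbrakk> \<Longrightarrow> s + t - s \<in> T"
    and "\<And>s t. \<lbrakk>s \<in> S; t \<in> T\<rbrakk> \<Longrightarrow> - s + t + s \<in> T"
  shows "\<forall>t\<in>T. f + t - f \<in> T \<and> - f + t + f \<in> T"
  using assms(1)
proof induction
  case (add f g)
  show ?case
  proof (intro ballI conjI)
    fix t assume t: "t \<in> T"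
    have "f + (g + t - g) - f \<in> T" "- g + (- f + t + f) + g \<in> T"
      using add.IH t by auto
    then show "f + g + t - (f + g) \<in> T" "- (f + g) + t + (f + g) \<in> T"
      by (simp_all add: group_word del: add_uminus_conv_diff)
  qed
qed (use assms(2,3) in auto)

section \<open>Multiplication groups of a loop\<close>

context loop
begin

lemma l_cancel [simp]:
  "\<lbrakk>x \<in> carrier Q; y \<in> carrier Q; z \<in> carrier Q\<rbrakk> \<Longrightarrow> x \<otimes> y = x \<otimes> z \<longleftrightarrow> y = z"
  using l_solve[of x "x \<otimes> z"] by auto

lemma r_cancel [simp]:
  "\<lbrakk>x \<in> carrier Q; y \<in> carrier Q; z \<in> carrier Q\<rbrakk> \<Longrightarrow> y \<otimes> x = z \<otimes> x \<longleftrightarrow> y = z"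
  using r_solve[of x "z \<otimes> x"] by auto

lemma ldiv_m [simp]: "\<lbrakk>x \<in> carrier Q; y \<in> carrier Q\<rbrakk> \<Longrightarrow> ldiv Q x (x \<otimes> y) = y"
  by (metis l_cancel ldiv_closed m_closed m_ldiv)

lemma m_rdiv [simp]: "\<lbrakk>x \<in> carrier Q; y \<in> carrier Q\<rbrakk> \<Longrightarrow> rdiv Q (y \<otimes> x) x = y"
  by (metis r_cancel rdiv_closed m_closed rdiv_m)

text \<open>Translations are extended by the identity outside the carrier.\<close>

definition L :: "'a \<Rightarrow> 'a bijection" where
  "L x = Bijection (\<lambda>y. if x \<in> carrier Q \<and> y \<in> carrier Q then x \<otimes> y else y)"

definition R :: "'a \<Rightarrow> 'a bijection" where
  "R x = Bijection (\<lambda>y. if x \<in> carrier Q \<and> y \<in> carrier Q then y \<otimes> x else y)"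

lemma L_app_if: "L x \<cdot> y = (if x \<in> carrier Q \<and> y \<in> carrier Q then x \<otimes> y else y)"
proof -
  have "bij (\<lambda>y. if x \<in> carrier Q \<and> y \<in> carrier Q then x \<otimes> y else y)"
    by (rule o_bij[of "\<lambda>y. if x \<in> carrier Q \<and> y \<in> carrier Q then ldiv Q x y else y"]) auto
  then show ?thesis by (simp add: L_def Bijection_inverse)
qed

lemma R_app_if: "R x \<cdot> y = (if x \<in> carrier Q \<and> y \<in> carrier Q then y \<otimes> x else y)"
proof -
  have "bij (\<lambda>y. if x \<in> carrier Q \<and> y \<in> carrier Q then y \<otimes> x else y)"
    by (rule o_bij[of "\<lambda>y. if x \<in> carrier Q \<and> y \<in> carrier Q then rdiv Q y x else y"]) auto
  then show ?thesis by (simp add: R_def Bijection_inverse)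
qed

lemma L_app [simp]: "\<lbrakk>x \<in> carrier Q; y \<in> carrier Q\<rbrakk> \<Longrightarrow> L x \<cdot> y = x \<otimes> y"
  and R_app [simp]: "\<lbrakk>x \<in> carrier Q; y \<in> carrier Q\<rbrakk> \<Longrightarrow> R x \<cdot> y = y \<otimes> x"
  by (simp_all add: L_app_if R_app_if)

lemma minus_L_app [simp]: "\<lbrakk>x \<in> carrier Q; y \<in> carrier Q\<rbrakk> \<Longrightarrow> - L x \<cdot> y = ldiv Q x y"
  and minus_R_app [simp]: "\<lbrakk>x \<in> carrier Q; y \<in> carrier Q\<rbrakk> \<Longrightarrow> - R x \<cdot> y = rdiv Q y x"
  by (metis L_app app_minus_app(1) ldiv_closed m_ldiv, metis R_app app_minus_app(1) rdiv_closed rdiv_m)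

text \<open>These are the permutations of the carrier, seen among those of the type; equality of two
  of them may be tested on the carrier alone (\<open>supported_eqI\<close>).\<close>

definition supported :: "'a bijection set" where
  "supported = {f. \<forall>y. y \<notin> carrier Q \<longrightarrow> f \<cdot> y = y}"

lemma supported_intros [intro, simp]:
  "L x \<in> supported" "R x \<in> supported" "0 \<in> supported"
  "\<lbrakk>f \<in> supported; g \<in> supported\<rbrakk> \<Longrightarrow> f + g \<in> supported"
  "f \<in> supported \<Longrightarrow> - f \<in> supported"
  "\<lbrakk>f \<in> supported; g \<in> supported\<rbrakk> \<Longrightarrow> f - g \<in> supported"
  by (simp_all add: supported_def L_app_if R_app_if) (metis app_minus_app(1))+

lemma app_closed [intro, simp]: "\<lbrakk>f \<in> supported; y \<in> carrier Q\<rbrakk> \<Longrightarrow> f \<cdot> y \<in> carrier Q"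
  by (metis (mono_tags, lifting) app_inj_iff mem_Collect_eq supported_def)

lemma supported_eqI:
  assumes "f \<in> supported" "g \<in> supported" "\<And>y. y \<in> carrier Q \<Longrightarrow> f \<cdot> y = g \<cdot> y"
  shows "f = g"
  using assms by (intro bijection_eqI) (metis (mono_tags, lifting) mem_Collect_eq supported_def)

text \<open>The left and right multiplication groups of the loop.\<close>

definition LM :: "'a bijection set" where "LM = subgroup_span (L ` carrier Q)"
definition RM :: "'a bijection set" where "RM = subgroup_span (R ` carrier Q)"

lemma LM_intros [intro, simp]:
  "x \<in> carrier Q \<Longrightarrow> L x \<in> LM"
  "\<lbrakk>f \<in> LM; g \<in> LM\<rbrakk> \<Longrightarrow> f + g \<in> LM" "f \<in> LM \<Longrightarrow> - f \<in> LM"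
  "\<lbrakk>f \<in> LM; g \<in> LM\<rbrakk> \<Longrightarrow> f - g \<in> LM"
  unfolding LM_def by (auto intro: subgroup_span.intros subgroup_span_diff)

lemma RM_intros [intro, simp]:
  "x \<in> carrier Q \<Longrightarrow> R x \<in> RM"
  "\<lbrakk>f \<in> RM; g \<in> RM\<rbrakk> \<Longrightarrow> f + g \<in> RM" "f \<in> RM \<Longrightarrow> - f \<in> RM"
  "\<lbrakk>f \<in> RM; g \<in> RM\<rbrakk> \<Longrightarrow> f - g \<in> RM"
  unfolding RM_def by (auto intro: subgroup_span.intros subgroup_span_diff)

lemma LM_supported [simp]: "f \<in> LM \<Longrightarrow> f \<in> supported"
  unfolding LM_def by (induction rule: subgroup_span.induct) auto

lemma RM_supported [simp]: "f \<in> RM \<Longrightarrow> f \<in> supported"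
  unfolding RM_def by (induction rule: subgroup_span.induct) auto

section \<open>The nucleus\<close>

definition nuc :: "'a set" where
  "nuc = {n \<in> carrier Q. \<forall>x\<in>carrier Q. \<forall>y\<in>carrier Q.
     (n \<otimes> x) \<otimes> y = n \<otimes> (x \<otimes> y) \<and> (x \<otimes> n) \<otimes> y = x \<otimes> (n \<otimes> y) \<and> (x \<otimes> y) \<otimes> n = x \<otimes> (y \<otimes> n)}"

lemma nuc_closed [intro, simp]: "n \<in> nuc \<Longrightarrow> n \<in> carrier Q"
  by (simp add: nuc_def)

lemma nuc_assoc:
  assumes "n \<in> nuc" "x \<in> carrier Q" "y \<in> carrier Q"
  shows "(n \<otimes> x) \<otimes> y = n \<otimes> (x \<otimes> y)" "(x \<otimes> n) \<otimes> y = x \<otimes> (n \<otimes> y)" "(x \<otimes> y) \<otimes> n = x \<otimes> (y \<otimes> n)"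
  using assms unfolding nuc_def by blast+

lemma one_nuc [intro, simp]: "\<one> \<in> nuc"
  unfolding nuc_def by simp

lemma R_nuc:
  assumes "n \<in> nuc" "y \<in> carrier Q"
  shows "R (n \<otimes> y) = R y + R n" "R (y \<otimes> n) = R n + R y"
  using assms by (auto intro!: supported_eqI simp: nuc_assoc)

text \<open>Associativity with \<open>n\<close> in the last place says that \<open>R n\<close>
  commutes with every \<open>L x\<close>; the generators of \<open>LM\<close> suffice.\<close>

lemma R_nuc_commute:
  assumes "n \<in> nuc" "f \<in> LM"
  shows "R n + f = f + R n"
  using assms(2) unfolding LM_def
proof (rule subgroup_span_commute)
  fix s assume "s \<in> L ` carrier Q"
  then show "R n + s = s + R n"
    using assms(1) by (auto intro!: supported_eqI simp: nuc_assoc)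
qed

end

section \<open>Conjugation of translations in CC-loops\<close>

context cc_loop
begin

text \<open>The case \<open>z = \<one>\<close> of conjugacy closure identifies the value of the
  unknown function.\<close>

lemma lcc:
  assumes "x \<in> carrier Q" "y \<in> carrier Q" "z \<in> carrier Q"
  shows "x \<otimes> (y \<otimes> z) = rdiv Q (x \<otimes> y) x \<otimes> (x \<otimes> z)"
proof -
  obtain f where f: "f \<in> carrier Q" "\<And>z. z \<in> carrier Q \<Longrightarrow> x \<otimes> (y \<otimes> z) = f \<otimes> (x \<otimes> z)"
    using conj_closed assms by (metis funcset_mem)
  have "x \<otimes> y = f \<otimes> x"
    using f(2)[of \<one>] assms by simp
  then show ?thesis using f assms by simp
qed

lemma rcc:
  assumes "x \<in> carrier Q" "y \<in> carrier Q" "z \<in> carrier Q"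
  shows "(z \<otimes> y) \<otimes> x = (z \<otimes> x) \<otimes> ldiv Q x (y \<otimes> x)"
proof -
  obtain g where g: "g \<in> carrier Q" "\<And>z. z \<in> carrier Q \<Longrightarrow> (z \<otimes> y) \<otimes> x = (z \<otimes> x) \<otimes> g"
    using conj_closed assms by (metis funcset_mem)
  have "y \<otimes> x = x \<otimes> g"
    using g(2)[of \<one>] assms by simp
  then show ?thesis using g assms by simp
qed

text \<open>Here \<open>lcc\<close> is read as an identity in its middle argument, which makes a
  left translation conjugate a right one. Read in its last argument it gives
  \<open>L_conj\<close>.\<close>

lemma R_conj_L:
  assumes "x \<in> carrier Q" "z \<in> carrier Q"
  shows "L x + R z - L x = R (x \<otimes> z) - R x"
proof -
  have "L x + R z = R (x \<otimes> z) - R x + L x"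
    using assms by (intro supported_eqI) (simp_all add: lcc[of x _ z])
  then show ?thesis by (simp add: group_word del: add_uminus_conv_diff)
qed

lemma L_conj_R:
  assumes "x \<in> carrier Q" "y \<in> carrier Q"
  shows "R x + L y - R x = L (y \<otimes> x) - L x"
proof -
  have "R x + L y = L (y \<otimes> x) - L x + R x"
    using assms by (intro supported_eqI) (simp_all add: rcc[of x _ y])
  then show ?thesis by (simp add: group_word del: add_uminus_conv_diff)
qed

text \<open>Subtracting the instances of \<open>R_conj_L\<close> at \<open>ldiv Q x z\<close> and
  \<open>ldiv Q x \<one>\<close> removes \<open>R x\<close>; conjugating back gives the
  claim.\<close>

lemma R_conj_minus_L:
  assumes "x \<in> carrier Q" "z \<in> carrier Q"
  shows "- L x + R z + L x = R (ldiv Q x z) - R (ldiv Q x \<one>)"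
proof -
  have 1: "R \<one> = 0"
    by (intro supported_eqI) auto
  have "L x + R (ldiv Q x z) - L x = R z - R x" "L x + R (ldiv Q x \<one>) - L x = - R x"
    using assms R_conj_L[of x "ldiv Q x z"] R_conj_L[of x "ldiv Q x \<one>"] by (simp_all add: 1)
  then have "(L x + R (ldiv Q x z) - L x) - (L x + R (ldiv Q x \<one>) - L x) = R z"
    by simp
  then have "L x + (R (ldiv Q x z) - R (ldiv Q x \<one>)) - L x = R z"
    by (simp add: group_word del: add_uminus_conv_diff)
  then have "R z = L x + (R (ldiv Q x z) - R (ldiv Q x \<one>)) - L x" ..
  then show ?thesis by (simp add: group_word del: add_uminus_conv_diff)
qed

lemma L_conj_minus_R:
  assumes "x \<in> carrier Q" "y \<in> carrier Q"
  shows "- R x + L y + R x = L (rdiv Q y x) - L (rdiv Q \<one> x)"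
proof -
  have 1: "L \<one> = 0"
    by (intro supported_eqI) auto
  have "R x + L (rdiv Q y x) - R x = L y - L x" "R x + L (rdiv Q \<one> x) - R x = - L x"
    using assms L_conj_R[of x "rdiv Q y x"] L_conj_R[of x "rdiv Q \<one> x"] by (simp_all add: 1)
  then have "(R x + L (rdiv Q y x) - R x) - (R x + L (rdiv Q \<one> x) - R x) = L y"
    by simp
  then have "R x + (L (rdiv Q y x) - L (rdiv Q \<one> x)) - R x = L y"
    by (simp add: group_word del: add_uminus_conv_diff)
  then have "L y = R x + (L (rdiv Q y x) - L (rdiv Q \<one> x)) - R x" ..
  then show ?thesis by (simp add: group_word del: add_uminus_conv_diff)
qed

lemma L_conj:
  assumes "x \<in> carrier Q" "y \<in> carrier Q"
  shows "L x + L y - L x = L (rdiv Q (x \<otimes> y) x)" "- L x + L y + L x = L (ldiv Q x (y \<otimes> x))"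
proof -
  have *: "L x + L y = L (rdiv Q (x \<otimes> y) x) + L x" if "y \<in> carrier Q" for y
    using assms that by (intro supported_eqI) (simp_all add: lcc[of x y])
  show "L x + L y - L x = L (rdiv Q (x \<otimes> y) x)"
    using *[OF assms(2)] by (simp add: group_word del: add_uminus_conv_diff)
  have "L x + L (ldiv Q x (y \<otimes> x)) = L y + L x"
    using *[of "ldiv Q x (y \<otimes> x)"] assms by simp
  then have "L y + L x = L x + L (ldiv Q x (y \<otimes> x))" ..
  then show "- L x + L y + L x = L (ldiv Q x (y \<otimes> x))"
    by (simp add: group_word del: add_uminus_conv_diff)
qed

lemma R_conj:
  assumes "x \<in> carrier Q" "y \<in> carrier Q"
  shows "R x + R y - R x = R (ldiv Q x (y \<otimes> x))" "- R x + R y + R x = R (rdiv Q (x \<otimes> y) x)"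
proof -
  have *: "R x + R y = R (ldiv Q x (y \<otimes> x)) + R x" if "y \<in> carrier Q" for y
    using assms that by (intro supported_eqI) (simp_all add: rcc[of x y])
  show "R x + R y - R x = R (ldiv Q x (y \<otimes> x))"
    using *[OF assms(2)] by (simp add: group_word del: add_uminus_conv_diff)
  have "R x + R (rdiv Q (x \<otimes> y) x) = R y + R x"
    using *[of "rdiv Q (x \<otimes> y) x"] assms by simp
  then have "R y + R x = R x + R (rdiv Q (x \<otimes> y) x)" ..
  then show "- R x + R y + R x = R (rdiv Q (x \<otimes> y) x)"
    by (simp add: group_word del: add_uminus_conv_diff)
qed

text \<open>Together with \<open>RM_conj_L\<close> this says that translations of one side normalize
  the multiplication group of the other side.\<close>

lemma LM_conj_R:
  assumes "x \<in> carrier Q" "f \<in> LM"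
  shows "R x + f - R x \<in> LM" "- R x + f + R x \<in> LM"
proof -
  show "R x + f - R x \<in> LM"
    using assms(2) unfolding LM_def
    by (rule subgroup_span_conjugate) (use assms(1) in \<open>auto simp: L_conj_R LM_def[symmetric]\<close>)
  have "- R x + f - (- R x) \<in> LM"
    using assms(2) unfolding LM_def
    by (rule subgroup_span_conjugate) (use assms(1) in \<open>auto simp: L_conj_minus_R LM_def[symmetric]\<close>)
  then show "- R x + f + R x \<in> LM" by simp
qed

lemma RM_conj_L:
  assumes "x \<in> carrier Q" "f \<in> RM"
  shows "L x + f - L x \<in> RM" "- L x + f + L x \<in> RM"
proof -
  show "L x + f - L x \<in> RM"
    using assms(2) unfolding RM_def
    by (rule subgroup_span_conjugate) (use assms(1) in \<open>auto simp: R_conj_L RM_def[symmetric]\<close>)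
  have "- L x + f - (- L x) \<in> RM"
    using assms(2) unfolding RM_def
    by (rule subgroup_span_conjugate) (use assms(1) in \<open>auto simp: R_conj_minus_L RM_def[symmetric]\<close>)
  then show "- L x + f + L x \<in> RM" by simp
qed

text \<open>By \<open>L_conj\<close> the left translations are closed under conjugation by one
  another, hence under conjugation by all of \<open>LM\<close>.\<close>

lemma LM_normalizes:
  assumes "f \<in> LM" "y \<in> carrier Q"
  obtains y' where "y' \<in> carrier Q" "f + L y = L y' + f"
proof -
  have "\<forall>t \<in> L ` carrier Q. f + t - f \<in> L ` carrier Q \<and> - f + t + f \<in> L ` carrier Q"
    using assms(1) unfolding LM_def
    by (rule subgroup_span_normalizes) (auto simp: L_conj)
  then obtain y' where "y' \<in> carrier Q" "f + L y - f = L y'"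
    using assms(2) by auto
  then show ?thesis using that by (metis diff_add_cancel)
qed

lemma RM_normalizes:
  assumes "f \<in> RM" "y \<in> carrier Q"
  obtains y' where "y' \<in> carrier Q" "f + R y = R y' + f"
proof -
  have "\<forall>t \<in> R ` carrier Q. f + t - f \<in> R ` carrier Q \<and> - f + t + f \<in> R ` carrier Q"
    using assms(1) unfolding RM_def
    by (rule subgroup_span_normalizes) (auto simp: R_conj)
  then obtain y' where "y' \<in> carrier Q" "f + R y - f = R y'"
    using assms(2) by auto
  then show ?thesis using that by (metis diff_add_cancel)
qed

text \<open>Evaluating \<open>f + L y = L y' + f\<close> at \<open>\<one>\<close> gives
  \<open>y' = f \<cdot> y\<close>; evaluating it at \<open>z\<close> then gives the claim.\<close>

lemma LM_fixing_one_hom: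
  assumes "f \<in> LM" "f \<cdot> \<one> = \<one>" "y \<in> carrier Q" "z \<in> carrier Q"
  shows "f \<cdot> (y \<otimes> z) = (f \<cdot> y) \<otimes> (f \<cdot> z)"
proof -
  obtain y' where y': "y' \<in> carrier Q" "f + L y = L y' + f"
    using LM_normalizes assms by blast
  have "f \<cdot> L y \<cdot> t = L y' \<cdot> f \<cdot> t" for t
    using y'(2) by (metis app_plus)
  from this[of \<one>] this[of z] show ?thesis
    using assms y'(1) by simp
qed

lemma RM_fixing_one_hom:
  assumes "f \<in> RM" "f \<cdot> \<one> = \<one>" "y \<in> carrier Q" "z \<in> carrier Q"
  shows "f \<cdot> (y \<otimes> z) = (f \<cdot> y) \<otimes> (f \<cdot> z)"
proof -
  obtain z' where z': "z' \<in> carrier Q" "f + R z = R z' + f"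
    using RM_normalizes assms by blast
  have "f \<cdot> R z \<cdot> t = R z' \<cdot> f \<cdot> t" for t
    using z'(2) by (metis app_plus)
  from this[of \<one>] this[of y] show ?thesis
    using assms z'(1) by simp
qed

section \<open>Coincidence of the three nuclei, and closure properties of the nucleus\<close>

text \<open>Conjugacy closure makes each nuclear condition imply the others: \<open>lcc\<close> at
  \<open>n\<close> rewrites \<open>n \<otimes> (x \<otimes> y)\<close> as a product with right
  factor \<open>n \<otimes> y\<close>, to which the middle condition applies; \<open>rcc\<close>
  does the same on the other side.\<close>

lemma nuc_middleI:
  assumes "n \<in> carrier Q"
    and m: "\<And>x y. \<lbrakk>x \<in> carrier Q; y \<in> carrier Q\<rbrakk> \<Longrightarrow> (x \<otimes> n) \<otimes> y = x \<otimes> (n \<otimes> y)"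
  shows "n \<in> nuc"
proof -
  have l: "(n \<otimes> x) \<otimes> y = n \<otimes> (x \<otimes> y)" if "x \<in> carrier Q" "y \<in> carrier Q" for x y
    using lcc[of n x y] m[of "rdiv Q (n \<otimes> x) n" y] assms(1) that by simp
  have r: "(x \<otimes> y) \<otimes> n = x \<otimes> (y \<otimes> n)" if "x \<in> carrier Q" "y \<in> carrier Q" for x y
    using rcc[of n y x] m[of x "ldiv Q n (y \<otimes> n)"] assms(1) that by simp
  show ?thesis
    unfolding nuc_def by (intro CollectI conjI ballI l m r assms(1))
qed

lemma nuc_leftI:
  assumes "n \<in> carrier Q"
    and l: "\<And>x y. \<lbrakk>x \<in> carrier Q; y \<in> carrier Q\<rbrakk> \<Longrightarrow> (n \<otimes> x) \<otimes> y = n \<otimes> (x \<otimes> y)"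
  shows "n \<in> nuc"
proof (rule nuc_middleI)
  fix x y assume xy: "x \<in> carrier Q" "y \<in> carrier Q"
  show "(x \<otimes> n) \<otimes> y = x \<otimes> (n \<otimes> y)"
    using lcc[of n "ldiv Q n (x \<otimes> n)" y] l[of "ldiv Q n (x \<otimes> n)" y] assms(1) xy by simp
qed (fact assms(1))

lemma nuc_rightI:
  assumes "n \<in> carrier Q"
    and r: "\<And>x y. \<lbrakk>x \<in> carrier Q; y \<in> carrier Q\<rbrakk> \<Longrightarrow> (x \<otimes> y) \<otimes> n = x \<otimes> (y \<otimes> n)"
  shows "n \<in> nuc"
proof (rule nuc_middleI)
  fix x y assume xy: "x \<in> carrier Q" "y \<in> carrier Q"
  show "(x \<otimes> n) \<otimes> y = x \<otimes> (n \<otimes> y)"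
    using rcc[of n "rdiv Q (n \<otimes> y) n" x] r[of x "rdiv Q (n \<otimes> y) n"] assms(1) xy by simp
qed (fact assms(1))

text \<open>Converse of \<open>R_nuc_commute\<close>: nuclear elements are recognized by their right
  translations centralizing \<open>LM\<close>.\<close>

lemma nuc_R_commuteI:
  assumes "n \<in> carrier Q" "\<And>f. f \<in> LM \<Longrightarrow> R n + f = f + R n"
  shows "n \<in> nuc"
proof (rule nuc_rightI)
  fix x y assume xy: "x \<in> carrier Q" "y \<in> carrier Q"
  then have "(R n + L x) \<cdot> y = (L x + R n) \<cdot> y"
    using assms(2) by simp
  then show "(x \<otimes> y) \<otimes> n = x \<otimes> (y \<otimes> n)"
    using xy assms(1) by simp
qed (fact assms(1))

text \<open>\<open>R x\<close> normalizes \<open>LM\<close> and therefore its centralizer, and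
  \<open>R_conj\<close> identifies the conjugates of \<open>R n\<close> as right
  translations.\<close>

lemma nuc_conj:
  assumes "n \<in> nuc" "x \<in> carrier Q"
  shows "ldiv Q x (n \<otimes> x) \<in> nuc" "rdiv Q (x \<otimes> n) x \<in> nuc"
proof -
  show "ldiv Q x (n \<otimes> x) \<in> nuc"
  proof (rule nuc_R_commuteI)
    fix f assume f: "f \<in> LM"
    have "R n + (- R x + f + R x) = (- R x + f + R x) + R n"
      using assms f by (intro R_nuc_commute LM_conj_R)
    then have "R x + (R n + (- R x + f + R x)) - R x = R x + ((- R x + f + R x) + R n) - R x"
      by simp
    then have "(R x + R n - R x) + f = f + (R x + R n - R x)"
      by (simp add: group_word del: add_uminus_conv_diff)
    then show "R (ldiv Q x (n \<otimes> x)) + f = f + R (ldiv Q x (n \<otimes> x))"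
      using assms by (simp add: R_conj)
  qed (use assms in auto)
  show "rdiv Q (x \<otimes> n) x \<in> nuc"
  proof (rule nuc_R_commuteI)
    fix f assume f: "f \<in> LM"
    have "R n + (R x + f - R x) = (R x + f - R x) + R n"
      using assms f by (intro R_nuc_commute LM_conj_R)
    then have "- R x + (R n + (R x + f - R x)) + R x = - R x + ((R x + f - R x) + R n) + R x"
      by simp
    then have "(- R x + R n + R x) + f = f + (- R x + R n + R x)"
      by (simp add: group_word del: add_uminus_conv_diff)
    then show "R (rdiv Q (x \<otimes> n) x) + f = f + R (rdiv Q (x \<otimes> n) x)"
      using assms by (simp add: R_conj)
  qed (use assms in auto)
qed

lemma nuc_m_closed [intro, simp]: "\<lbrakk>n \<in> nuc; m \<in> nuc\<rbrakk> \<Longrightarrow> n \<otimes> m \<in> nuc"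
  by (rule nuc_leftI) (auto simp: nuc_assoc)

text \<open>The centralizer of \<open>LM\<close> contains \<open>- R n\<close> along with
  \<open>R n\<close>.\<close>

lemma nuc_inverse:
  assumes "n \<in> nuc"
  shows "R (ldiv Q n \<one>) = - R n" "ldiv Q n \<one> \<in> nuc"
proof -
  have "R \<one> = 0"
    by (intro supported_eqI) auto
  then have "R (ldiv Q n \<one>) + R n = 0"
    using R_nuc(1)[of n "ldiv Q n \<one>"] assms by simp
  then show R: "R (ldiv Q n \<one>) = - R n"
    by (simp add: eq_neg_iff_add_eq_0)
  show "ldiv Q n \<one> \<in> nuc"
  proof (rule nuc_R_commuteI)
    fix f assume f: "f \<in> LM"
    have "- f \<in> LM" using f by simp
    then have "R n + - f = - f + R n"
      using R_nuc_commute assms by blast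
    then have "- (R n + - f) = - (- f + R n)" by simp
    then show "R (ldiv Q n \<one>) + f = f + R (ldiv Q n \<one>)"
      unfolding R by (simp add: group_word del: add_uminus_conv_diff)
  qed (use assms in auto)
qed

section \<open>Multiplications with nuclear values\<close>

text \<open>Split \<open>s = L n + f\<close>, where \<open>f\<close> fixes \<open>\<one>\<close> and
  is thus an automorphism. Being in \<open>RM\<close>, \<open>s\<close> conjugates
  \<open>R y'\<close> to some \<open>R z\<close>. With \<open>x'\<close>, \<open>y'\<close> the
  preimages of \<open>x\<close>, \<open>y\<close> under \<open>f\<close>, evaluation at
  \<open>\<one>\<close> forces \<open>z = y\<close>, and evaluation at \<open>x'\<close> is the left
  nuclear law for \<open>n\<close>.\<close>

lemma LM_RM_nuc:
  assumes "s \<in> LM" "s \<in> RM"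
  shows "s \<cdot> \<one> \<in> nuc"
proof -
  define n where "n = s \<cdot> \<one>"
  define f where "f = - L n + s"
  have n: "n \<in> carrier Q"
    using assms by (simp add: n_def)
  then have "ldiv Q n n = \<one>"
    using ldiv_m[of n \<one>] by simp
  then have f: "f \<in> LM" "f \<cdot> \<one> = \<one>"
    using assms n by (simp_all add: f_def n_def[symmetric])
  have s: "s = L n + f"
    by (simp add: f_def)
  show ?thesis
    unfolding n_def[symmetric]
  proof (rule nuc_leftI[OF n])
    fix x y assume xy: "x \<in> carrier Q" "y \<in> carrier Q"
    define x' y' where "x' = - f \<cdot> x" and "y' = - f \<cdot> y"
    have xy': "x' \<in> carrier Q" "y' \<in> carrier Q" "f \<cdot> x' = x" "f \<cdot> y' = y"
      using xy f by (simp_all add: x'_def y'_def)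
    obtain z where z: "z \<in> carrier Q" "s + R y' = R z + s"
      using RM_normalizes assms xy' by blast
    have eq: "s \<cdot> R y' \<cdot> t = R z \<cdot> s \<cdot> t" for t
      using z(2) by (metis app_plus)
    have "n \<otimes> y = n \<otimes> z"
      using eq[of \<one>] xy xy' z(1) n by (simp add: n_def[symmetric]) (simp add: s xy)
    then have "z = y"
      using n z xy by simp
    then show "(n \<otimes> x) \<otimes> y = n \<otimes> (x \<otimes> y)"
      using eq[of x'] xy xy' n f by (simp add: s LM_fixing_one_hom)
  qed
qed

text \<open>The conclusion \<open>R n \<in> LM\<close> is recorded because it makes \<open>n\<close>
  commute with the nucleus (\<open>nuc_commute\<close>).\<close>

lemma LM_fixing_one_nuc:
  assumes "f \<in> LM" "f \<cdot> \<one> = \<one>" "w \<in> carrier Q"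
  obtains n where "n \<in> nuc" "R n \<in> LM" "f \<cdot> w = n \<otimes> w"
proof -
  \<comment> \<open>Since \<open>f\<close> is an automorphism,
    \<open>R (f \<cdot> w) = f + R w - f\<close>, so \<open>s\<close> is a commutator of
    \<open>f\<close> with a translation. It lies in \<open>RM\<close> by its form and in
    \<open>LM\<close> because \<open>R w\<close> normalizes \<open>LM\<close>.\<close>
  define s where "s = - R w + R (f \<cdot> w)"
  have fw: "f \<cdot> w \<in> carrier Q"
    using assms by simp
  have "f + R w = R (f \<cdot> w) + f"
    using assms by (intro supported_eqI) (auto simp: LM_fixing_one_hom)
  then have "R (f \<cdot> w) = f + R w - f"
    by (simp add: group_word del: add_uminus_conv_diff)
  then have "s = (- R w + f + R w) - f"
    by (simp add: s_def group_word del: add_uminus_conv_diff)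
  then have s: "s \<in> LM"
    using assms LM_conj_R by simp
  moreover have "s \<in> RM"
    using assms by (simp add: s_def)
  ultimately have n: "s \<cdot> \<one> \<in> nuc"
    by (rule LM_RM_nuc)
  have fw': "f \<cdot> w = (s \<cdot> \<one>) \<otimes> w"
    using assms by (simp add: s_def)
  then have "R (f \<cdot> w) = R w + R (s \<cdot> \<one>)"
    using n R_nuc(1) assms(3) by simp
  then have "- R w + R (f \<cdot> w) = R (s \<cdot> \<one>)"
    by simp
  then have "R (s \<cdot> \<one>) = s"
    by (metis s_def)
  then show ?thesis
    using that[of "s \<cdot> \<one>"] n s fw' by simp
qed

text \<open>Mirror image of the previous argument, with the nuclear factor on the right.\<close>

lemma RM_fixing_one_nuc:
  assumes "f \<in> RM" "f \<cdot> \<one> = \<one>" "w \<in> carrier Q"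
  obtains n where "n \<in> nuc" "f \<cdot> w = w \<otimes> n"
proof -
  define s where "s = - L w + L (f \<cdot> w)"
  have fw: "f \<cdot> w \<in> carrier Q"
    using assms by simp
  have "f + L w = L (f \<cdot> w) + f"
    using assms by (intro supported_eqI) (auto simp: RM_fixing_one_hom)
  then have "L (f \<cdot> w) = f + L w - f"
    by (simp add: group_word del: add_uminus_conv_diff)
  then have "s = (- L w + f + L w) - f"
    by (simp add: s_def group_word del: add_uminus_conv_diff)
  then have "s \<in> RM"
    using assms RM_conj_L by simp
  moreover have "s \<in> LM"
    using assms by (simp add: s_def)
  ultimately have "s \<cdot> \<one> \<in> nuc"
    using LM_RM_nuc by blast
  moreover have "f \<cdot> w = w \<otimes> (s \<cdot> \<one>)"
    using assms by (simp add: s_def)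
  ultimately show ?thesis
    using that by blast
qed

lemma nuc_commute:
  assumes "n \<in> nuc" "R n \<in> LM" "m \<in> nuc"
  shows "n \<otimes> m = m \<otimes> n"
proof -
  have "(R m + R n) \<cdot> \<one> = (R n + R m) \<cdot> \<one>"
    using R_nuc_commute[OF assms(3,2)] by simp
  then show ?thesis using assms by simp
qed

section \<open>Commutators are nuclear\<close>

text \<open>A normal subgroup of \<open>RM\<close>, by \<open>RN_intros\<close> and
  \<open>RN_conj\<close>; the calculations below are made modulo it.\<close>

definition RN :: "'a bijection set" where "RN = R ` nuc"

lemma RN_intros [intro, simp]:
  "\<lbrakk>m \<in> RN; m' \<in> RN\<rbrakk> \<Longrightarrow> m + m' \<in> RN" "m \<in> RN \<Longrightarrow> - m \<in> RN" "0 \<in> RN"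
proof -
  show "m + m' \<in> RN" if mm': "m \<in> RN" "m' \<in> RN" for m m'
  proof -
    obtain n n' where "n \<in> nuc" "n' \<in> nuc" "m = R n" "m' = R n'"
      using mm' unfolding RN_def by blast
    then have "m + m' = R (n' \<otimes> n)" "n' \<otimes> n \<in> nuc"
      by (simp_all add: R_nuc)
    then show ?thesis by (simp add: RN_def)
  qed
  show "- m \<in> RN" if m: "m \<in> RN" for m
  proof -
    obtain n where n: "n \<in> nuc" "m = R n"
      using m unfolding RN_def by blast
    then have "- m = R (ldiv Q n \<one>)"
      by (simp add: nuc_inverse)
    then show ?thesis
      using nuc_inverse(2)[OF n(1)] by (simp add: RN_def)
  qed
  have "R \<one> = 0"
    by (intro supported_eqI) auto
  then show "0 \<in> RN"
    unfolding RN_def by (metis image_eqI one_nuc)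
qed

text \<open>This turns an equality modulo \<open>RN\<close> into an exact one when both sides fix
  \<open>\<one>\<close>.\<close>

lemma RN_fixing_one: "\<lbrakk>m \<in> RN; m \<cdot> \<one> = \<one>\<rbrakk> \<Longrightarrow> m = 0"
proof -
  assume "m \<in> RN" "m \<cdot> \<one> = \<one>"
  then have "m = R \<one>"
    by (auto simp: RN_def)
  then show "m = 0"
    by (auto intro: supported_eqI)
qed

lemma RN_conj:
  assumes "g \<in> RM" "m \<in> RN"
  shows "g + m - g \<in> RN" "- g + m + g \<in> RN"
proof -
  have "\<forall>t \<in> RN. g + t - g \<in> RN \<and> - g + t + g \<in> RN"
    using assms(1) unfolding RM_def
    by (rule subgroup_span_normalizes) (auto simp: RN_def R_conj nuc_conj)
  then show "g + m - g \<in> RN" "- g + m + g \<in> RN"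
    using assms(2) by auto
qed

lemma RN_move:
  assumes "g \<in> RM" "m \<in> RN"
  obtains m' where "m' \<in> RN" "m + g = g + m'"
proof
  show "- g + m + g \<in> RN"
    using assms by (rule RN_conj)
  show "m + g = g + (- g + m + g)"
    by (simp add: group_word del: add_uminus_conv_diff)
qed

text \<open>For a generator, \<open>r + R v - r = R (r \<cdot> v)\<close>, and
  \<open>r \<cdot> v\<close> is \<open>v\<close> times a nuclear element. Normality of
  \<open>RN\<close> extends this to all of \<open>RM\<close>.\<close>

lemma RM_fixing_one_commute:
  assumes r: "r \<in> RM" "r \<cdot> \<one> = \<one>" and "g \<in> RM"
  shows "\<exists>m\<in>RN. r + g = g + r + m"
proof -
  \<comment> \<open>Membership in \<open>RM\<close> is carried along because \<open>RN_move\<close>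
    needs it for sums and inverses.\<close>
  have "g \<in> RM \<and> (\<exists>m\<in>RN. r + g = g + r + m)"
    using assms(3)[unfolded RM_def]
  proof induction
    case (base s)
    then obtain v where v: "v \<in> carrier Q" "s = R v"
      by blast
    obtain n where n: "n \<in> nuc" "r \<cdot> v = v \<otimes> n"
      using RM_fixing_one_nuc r v(1) by blast
    have "r + R v = R (r \<cdot> v) + r"
      using r v by (intro supported_eqI) (auto simp: RM_fixing_one_hom)
    also have "\<dots> = R n + (R v + r)"
      using n v R_nuc(2) by (simp add: add.assoc)
    finally have eq: "r + R v = R n + (R v + r)" .
    moreover have "R n \<in> RN"
      using n by (simp add: RN_def)
    moreover have "R v + r \<in> RM"
      using v r by simp
    ultimately show ?case
      using RN_move v by (metis RM_intros(1))
  next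
    case zero
    show ?case
      using RN_intros(3) by (metis add.right_neutral add.left_neutral diff_self RM_intros(4) r(1))
  next
    case (add f g)
    then obtain m m' where m: "f \<in> RM" "g \<in> RM" "m \<in> RN" "m' \<in> RN"
      "r + f = f + r + m" "r + g = g + r + m'"
      by blast
    obtain m'' where m'': "m'' \<in> RN" "m + g = g + m''"
      using RN_move m by blast
    have "r + (f + g) = (f + r + m) + g"
      using m(5) by (metis add.assoc)
    also have "\<dots> = f + (r + g) + m''"
      using m''(2) by (simp add: add.assoc)
    also have "\<dots> = (f + g) + r + (m' + m'')"
      using m(6) by (simp add: add.assoc)
    finally show ?case
      using m m'' by (metis RN_intros(1) RM_intros(2))
  next
    case (minus g)
    then obtain m where m: "g \<in> RM" "m \<in> RN" "r + g = g + r + m"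
      by blast
    obtain m' where m': "m' \<in> RN" "m + - g = - g + m'"
      using RN_move[of "- g" m] m by blast
    have "- g + (r + g) + - g = - g + (g + r + m) + - g"
      using m(3) by simp
    then have "- g + r = r + - g + m'"
      using m'(2) by (simp add: group_word del: add_uminus_conv_diff)
    then have "r + - g = - g + r + - m'"
      by (simp add: group_word del: add_uminus_conv_diff)
    then show ?case
      using m m' by (metis RN_intros(2) RM_intros(3))
  qed
  then show ?thesis by blast
qed

text \<open>
  With $r_w = R_x^{-1} R_w^{-1} R_{xw}$, conjugating $R_v R_u = R_{u'} R_v$ by $L_x$ gives
  $r_v r_u = r_{u'} r_v$ modulo right translations by nuclear elements, and the $r_w$ commute modulo
  these. As the $r_w$ fix the identity, both hold exactly.
\<close>

lemma R_conjugate_invariant: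
  assumes x: "x \<in> carrier Q" and u: "u \<in> carrier Q" and v: "v \<in> carrier Q"
  defines "u' \<equiv> ldiv Q v (u \<otimes> v)"
  shows "- R u + R (x \<otimes> u) = - R u' + R (x \<otimes> u')"
proof -
  define r where "r w = - R x - R w + R (x \<otimes> w)" for w
  have u': "u' \<in> carrier Q"
    using u v by (simp add: u'_def)
  have r: "r w \<in> RM" "r w \<cdot> \<one> = \<one>" if "w \<in> carrier Q" for w
  proof -
    show "r w \<in> RM"
      using x that by (simp add: r_def)
    have "rdiv Q x x = \<one>"
      using m_rdiv[of x \<one>] x by simp
    then show "r w \<cdot> \<one> = \<one>"
      using x that by (simp add: r_def)
  qed
  have Rr: "R (x \<otimes> w) = R w + R x + r w" for w
    by (simp add: r_def group_word del: add_uminus_conv_diff)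
  have uv: "R v + R u = R u' + R v"
    using R_conj(1)[OF v u] unfolding u'_def by (metis diff_add_cancel)
  have conj: "(R (x \<otimes> a) - R x) + (R (x \<otimes> b) - R x) = L x + (R a + R b) - L x"
    if "a \<in> carrier Q" "b \<in> carrier Q" for a b
    unfolding R_conj_L[OF x that(1), symmetric] R_conj_L[OF x that(2), symmetric]
    by (simp add: group_word del: add_uminus_conv_diff)
  have "(R (x \<otimes> v) - R x) + (R (x \<otimes> u) - R x) = (R (x \<otimes> u') - R x) + (R (x \<otimes> v) - R x)"
    using conj[OF v u] conj[OF u' v] uv by simp
  then have "(R (x \<otimes> v) - R x) + (R (x \<otimes> u) - R x) + R x
      = (R (x \<otimes> u') - R x) + (R (x \<otimes> v) - R x) + R x"
    by simp
  then have main: "R v + R x + (r v + (- R x + R u + R x)) + r u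
      = R u' + R x + (r u' + (- R x + R v + R x)) + r v"
    unfolding Rr by (simp add: group_word del: add_uminus_conv_diff)
  \<comment> \<open>Expanding with \<open>Rr\<close> leaves these conjugates between the
    \<open>r\<close> factors. They lie in \<open>RM\<close>, so an \<open>r\<close> moves past them
    at the cost of a factor in \<open>RN\<close>.\<close>
  define g h where "g = - R x + R u + R x" and "h = - R x + R v + R x"
  have gh: "g \<in> RM" "h \<in> RM"
    using x u v by (simp_all add: g_def h_def)
  obtain m where m: "m \<in> RN" "r v + g = g + r v + m"
    using RM_fixing_one_commute[OF r[OF v] gh(1)] by blast
  obtain k where k: "k \<in> RN" "r u' + h = h + r u' + k"
    using RM_fixing_one_commute[OF r[OF u'] gh(2)] by blast
  obtain m' where m': "m' \<in> RN" "m + r u = r u + m'"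
    using RN_move[OF r(1)[OF u] m(1)] by blast
  obtain k' where k': "k' \<in> RN" "k + r v = r v + k'"
    using RN_move[OF r(1)[OF v] k(1)] by blast
  have "R v + R x + (g + r v + m) + r u = R u' + R x + (h + r u' + k) + r v"
    using main m(2) k(2) by (simp add: g_def h_def)
  then have "(R v + R x + g) + (r v + r u + m') = (R u' + R x + h) + (r u' + r v + k')"
    using m'(2) k'(2) by (simp add: add.assoc)
  \<comment> \<open>The sums telescope to \<open>R u' + R v + R x\<close> and
    \<open>R v + R u + R x\<close>, which agree by \<open>uv\<close>.\<close>
  moreover have "R u' + R x + h = R v + R x + g"
    using uv by (simp add: g_def h_def add.assoc[symmetric])
  ultimately have "(R v + R x + g) + (r v + r u + m') = (R v + R x + g) + (r u' + r v + k')"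
    by (simp only:)
  then have rr: "r v + r u + m' = r u' + r v + k'"
    by (simp only: add_left_cancel)
  have "r v + r u + (m' + - k') = r v + r u + m' + - k'"
    by (simp only: add.assoc)
  also have "\<dots> = r u' + r v"
    unfolding rr by (simp add: group_word del: add_uminus_conv_diff)
  finally have "r v + r u + (m' + - k') = r u' + r v" .
  moreover obtain l where l: "l \<in> RN" "r v + r u = r u + r v + l"
    using RM_fixing_one_commute[OF r[OF v] r(1)[OF u]] by blast
  ultimately have eq: "r u' + r v = r u + r v + (l + (m' + - k'))"
    by (simp add: add.assoc)
  \<comment> \<open>Both sums fix \<open>\<one>\<close>, so the remaining factor in
    \<open>RN\<close> does too and must vanish.\<close>
  have "(r u' + r v) \<cdot> \<one> = \<one>" "(r u + r v) \<cdot> \<one> = \<one>"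
    using r u u' v by simp_all
  then have "(l + (m' + - k')) \<cdot> \<one> = \<one>"
    using eq by (metis app_inj_iff app_plus)
  then have "l + (m' + - k') = 0"
    using l(1) m'(1) k'(1) by (intro RN_fixing_one RN_intros)
  then have "r u' = r u"
    using eq by simp
  then have "R x + r u = R x + r u'" by simp
  then show ?thesis
    by (simp add: r_def group_word del: add_uminus_conv_diff)
qed

text \<open>The standard left inner mapping; as an element of \<open>LM\<close> fixing
  \<open>\<one>\<close> it is an automorphism here.\<close>

definition left_inner :: "'a \<Rightarrow> 'a \<Rightarrow> 'a bijection" where
  "left_inner x y = - L (x \<otimes> y) + L x + L y"

lemma left_inner:
  assumes "x \<in> carrier Q" "y \<in> carrier Q"
  shows "left_inner x y \<in> LM" "left_inner x y \<cdot> \<one> = \<one>"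
proof -
  show "left_inner x y \<in> LM"
    using assms by (simp add: left_inner_def)
  show "left_inner x y \<cdot> \<one> = \<one>"
    using assms ldiv_m[of "x \<otimes> y" \<one>] by (simp add: left_inner_def)
qed

lemma left_inner_app:
  assumes "x \<in> carrier Q" "y \<in> carrier Q" "z \<in> carrier Q"
  shows "(x \<otimes> y) \<otimes> (left_inner x y \<cdot> z) = x \<otimes> (y \<otimes> z)"
  using assms by (simp add: left_inner_def)

text \<open>An inner mapping \<open>f\<close> multiplies \<open>u\<close> and \<open>u'\<close> by
  nuclear elements \<open>m\<close> and \<open>m'\<close>. The invariance of
  \<open>- R u + R (x \<otimes> u)\<close> gives \<open>m = m'\<close>, so \<open>f\<close> fixes
  \<open>n\<close>. For all left inner mappings together this is the right nuclear law for
  \<open>n\<close>.\<close>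

lemma commutator_nuc:
  assumes u: "u \<in> carrier Q" and v: "v \<in> carrier Q"
  obtains n where "n \<in> nuc" "u \<otimes> v = (v \<otimes> u) \<otimes> n"
proof -
  define u' where "u' = ldiv Q v (u \<otimes> v)"
  define n where "n = ldiv Q u u'"
  have u': "u' \<in> carrier Q" "v \<otimes> u' = u \<otimes> v"
    using u v by (simp_all add: u'_def)
  have n: "n \<in> carrier Q" "u \<otimes> n = u'"
    using u u' by (simp_all add: n_def)
  have "n \<in> nuc"
  proof (rule nuc_rightI[OF n(1)])
    fix w x assume wx: "w \<in> carrier Q" "x \<in> carrier Q"
    define f where "f = left_inner w x"
    have f: "f \<in> LM" "f \<cdot> \<one> = \<one>" "\<And>z. z \<in> carrier Q \<Longrightarrow> (w \<otimes> x) \<otimes> (f \<cdot> z) = w \<otimes> (x \<otimes> z)"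
      using wx by (simp_all add: f_def left_inner left_inner_app)
    obtain m where m: "m \<in> nuc" "f \<cdot> u = m \<otimes> u"
      using LM_fixing_one_nuc f u by blast
    obtain m' where m': "m' \<in> nuc" "f \<cdot> u' = m' \<otimes> u'"
      using LM_fixing_one_nuc f u' by blast
    have "w \<otimes> (x \<otimes> u) = ((w \<otimes> x) \<otimes> m) \<otimes> u" "w \<otimes> (x \<otimes> u') = ((w \<otimes> x) \<otimes> m') \<otimes> u'"
      using f(3)[OF u] f(3)[OF u'(1)] m m' wx u u'(1) by (simp_all only: nuc_assoc(2) m_closed)
    \<comment> \<open>Dividing off the last factor isolates \<open>m\<close> in a form that depends
      on \<open>u\<close> only through the invariant operator.\<close>
    then have "(- R u + R (x \<otimes> u)) \<cdot> w = (w \<otimes> x) \<otimes> m" "(- R u' + R (x \<otimes> u')) \<cdot> w = (w \<otimes> x) \<otimes> m'"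
      using wx u u' m m' by simp_all
    then have "(w \<otimes> x) \<otimes> m = (w \<otimes> x) \<otimes> m'"
      using R_conjugate_invariant[OF wx(2) u v, folded u'_def] by simp
    then have "m = m'"
      using wx m(1) m'(1) by simp
    then have "f \<cdot> (u \<otimes> n) = m \<otimes> (u \<otimes> n)"
      using m'(2) n(2) by simp
    moreover have "f \<cdot> (u \<otimes> n) = (m \<otimes> u) \<otimes> (f \<cdot> n)"
      using f u n(1) m(2) by (simp add: LM_fixing_one_hom)
    ultimately have "f \<cdot> n = n"
      using m(1) u n(1) f(1) by (simp add: nuc_assoc)
    then show "(w \<otimes> x) \<otimes> n = w \<otimes> (x \<otimes> n)"
      using f(3)[OF n(1)] by simp
  qed
  moreover have "u \<otimes> v = (v \<otimes> u) \<otimes> n"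
    using u' n calculation u v by (simp add: nuc_assoc)
  ultimately show ?thesis
    using that by blast
qed

section \<open>Associators\<close>

text \<open>The centre of the nucleus as a group, not of the loop: its elements need not commute
  with all of \<open>Q\<close>, whence \<open>conj_by\<close>.\<close>

definition nuc_center :: "'a set" where
  "nuc_center = {n \<in> nuc. \<forall>m\<in>nuc. n \<otimes> m = m \<otimes> n}"

lemma nuc_center_nuc [simp]: "n \<in> nuc_center \<Longrightarrow> n \<in> nuc"
  by (simp add: nuc_center_def)

lemma nuc_center_closed [simp]: "n \<in> nuc_center \<Longrightarrow> n \<in> carrier Q"
  by simp

lemma nuc_center_commute: "\<lbrakk>n \<in> nuc_center; m \<in> nuc\<rbrakk> \<Longrightarrow> n \<otimes> m = m \<otimes> n"
  unfolding nuc_center_def by blast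

lemma nuc_centerI: "\<lbrakk>n \<in> nuc; \<And>m. m \<in> nuc \<Longrightarrow> n \<otimes> m = m \<otimes> n\<rbrakk> \<Longrightarrow> n \<in> nuc_center"
  unfolding nuc_center_def by blast

text \<open>The \<open>n^x\<close> of the overview: what \<open>n\<close> becomes when carried from
  the left of \<open>x\<close> to its right.\<close>

definition conj_by :: "'a \<Rightarrow> 'a \<Rightarrow> 'a" where
  "conj_by n x = ldiv Q x (n \<otimes> x)"

lemma m_conj_by: "\<lbrakk>n \<in> carrier Q; x \<in> carrier Q\<rbrakk> \<Longrightarrow> x \<otimes> conj_by n x = n \<otimes> x"
  by (simp add: conj_by_def)

lemma conj_by_one [simp]: "x \<in> carrier Q \<Longrightarrow> conj_by \<one> x = \<one>"
  using ldiv_m[of x \<one>] by (simp add: conj_by_def)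

lemma conj_by_nuc [simp]: "\<lbrakk>n \<in> nuc; x \<in> carrier Q\<rbrakk> \<Longrightarrow> conj_by n x \<in> nuc"
  by (simp add: conj_by_def nuc_conj)

text \<open>Conjugation by \<open>x\<close> maps onto the nucleus: \<open>m\<close> is the conjugate
  of a nuclear \<open>k\<close>, and \<open>n\<close> commutes with \<open>k\<close>.\<close>

lemma conj_by_nuc_center [simp]:
  assumes "n \<in> nuc_center" "x \<in> carrier Q"
  shows "conj_by n x \<in> nuc_center"
proof -
  have "conj_by n x \<otimes> m = m \<otimes> conj_by n x" if m: "m \<in> nuc" for m
  proof -
    define k where "k = rdiv Q (x \<otimes> m) x"
    have k: "k \<in> nuc" "k \<otimes> x = x \<otimes> m"
      using m assms by (simp_all add: k_def nuc_conj)
    have n: "n \<in> nuc" "n \<otimes> k = k \<otimes> n" and c: "conj_by n x \<in> nuc" "x \<otimes> conj_by n x = n \<otimes> x"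
      using assms k nuc_center_commute by (simp_all add: m_conj_by)
    have "x \<otimes> (conj_by n x \<otimes> m) = n \<otimes> (k \<otimes> x)"
      using c n m k assms(2) by (metis nuc_assoc(1,3) nuc_closed)
    also have "\<dots> = k \<otimes> (x \<otimes> conj_by n x)"
      using n c k assms(2) by (metis nuc_assoc(1) nuc_closed)
    also have "\<dots> = x \<otimes> (m \<otimes> conj_by n x)"
      using k c m assms(2) by (metis nuc_assoc(1,3) nuc_closed)
    finally show ?thesis
      using assms(2) c m by simp
  qed
  then show ?thesis
    using assms by (intro nuc_centerI) simp_all
qed

lemma conj_by_m:
  assumes "n \<in> nuc" "m \<in> nuc" "x \<in> carrier Q"
  shows "conj_by (n \<otimes> m) x = conj_by n x \<otimes> conj_by m x"
proof -
  have "x \<otimes> conj_by (n \<otimes> m) x = n \<otimes> (m \<otimes> x)"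
    using assms by (simp add: m_conj_by nuc_assoc)
  also have "\<dots> = n \<otimes> (x \<otimes> conj_by m x)"
    using assms by (simp add: m_conj_by)
  also have "\<dots> = (n \<otimes> x) \<otimes> conj_by m x"
    using assms by (simp add: nuc_assoc)
  also have "\<dots> = x \<otimes> (conj_by n x \<otimes> conj_by m x)"
    using assms by (simp add: m_conj_by[of n, symmetric] nuc_assoc)
  finally show ?thesis
    using assms by simp
qed

lemma conj_by_nuc_trivial: "\<lbrakk>n \<in> nuc_center; m \<in> nuc\<rbrakk> \<Longrightarrow> conj_by n m = n"
  by (simp add: conj_by_def nuc_center_commute)

lemma conj_by_eq_one: "\<lbrakk>n \<in> carrier Q; x \<in> carrier Q; conj_by n x = \<one>\<rbrakk> \<Longrightarrow> n = \<one>"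
  using m_conj_by[of n x] by (metis l_one one_closed r_cancel r_one)

definition associator :: "'a \<Rightarrow> 'a \<Rightarrow> 'a \<Rightarrow> 'a" where
  "associator x y z = ldiv Q ((x \<otimes> y) \<otimes> z) (x \<otimes> (y \<otimes> z))"

text \<open>\<open>LM_fixing_one_nuc\<close> yields a nuclear factor to the left of
  \<open>z\<close>, central in the nucleus since its right translation lies in \<open>LM\<close>.
  Carried to the right of \<open>z\<close>, it can be pulled out of the whole product.\<close>

lemma left_inner_associator:
  assumes "x \<in> carrier Q" "y \<in> carrier Q" "z \<in> carrier Q"
  shows "associator x y z \<in> nuc_center" "left_inner x y \<cdot> z = z \<otimes> associator x y z"
proof -
  define f where "f = left_inner x y"
  have f: "f \<in> LM" "f \<cdot> \<one> = \<one>" "(x \<otimes> y) \<otimes> (f \<cdot> z) = x \<otimes> (y \<otimes> z)"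
    using assms by (simp_all add: f_def left_inner left_inner_app)
  obtain n where n: "n \<in> nuc" "R n \<in> LM" "f \<cdot> z = n \<otimes> z"
    using LM_fixing_one_nuc f assms(3) by blast
  then have "n \<in> nuc_center"
    by (intro nuc_centerI nuc_commute)
  then have c: "conj_by n z \<in> nuc_center"
    using assms by simp
  have "f \<cdot> z = z \<otimes> conj_by n z"
    using n assms by (simp add: m_conj_by)
  moreover then have "x \<otimes> (y \<otimes> z) = ((x \<otimes> y) \<otimes> z) \<otimes> conj_by n z"
    using f(3) c assms by (metis m_closed nuc_assoc(3) nuc_center_nuc)
  then have "associator x y z = conj_by n z"
    using c assms by (simp add: associator_def)
  ultimately show "associator x y z \<in> nuc_center" "left_inner x y \<cdot> z = z \<otimes> associator x y z"
    using c by (simp_all add: f_def)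
qed

lemmas associator_nuc_center [simp] = left_inner_associator(1)

lemma m_associator:
  assumes "x \<in> carrier Q" "y \<in> carrier Q" "z \<in> carrier Q"
  shows "x \<otimes> (y \<otimes> z) = ((x \<otimes> y) \<otimes> z) \<otimes> associator x y z"
  using assms by (simp add: associator_def)

lemma associator_eqI:
  assumes "x \<in> carrier Q" "y \<in> carrier Q" "z \<in> carrier Q" "n \<in> carrier Q"
    and "x \<otimes> (y \<otimes> z) = ((x \<otimes> y) \<otimes> z) \<otimes> n"
  shows "associator x y z = n"
  using assms by (simp add: associator_def)

lemma associator_eq_one_iff:
  assumes "x \<in> carrier Q" "y \<in> carrier Q" "z \<in> carrier Q"
  shows "associator x y z = \<one> \<longleftrightarrow> (x \<otimes> y) \<otimes> z = x \<otimes> (y \<otimes> z)"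
proof
  assume "associator x y z = \<one>"
  with m_associator[OF assms] show "(x \<otimes> y) \<otimes> z = x \<otimes> (y \<otimes> z)"
    using assms by (metis m_closed r_one)
qed (use assms in \<open>auto intro!: associator_eqI\<close>)

text \<open>The automorphism \<open>left_inner x y\<close> multiplies each argument by an
  associator. In the image of \<open>z \<otimes> w\<close> the factor belonging to \<open>z\<close>
  has to be carried past \<open>w\<close>.\<close>

lemma associator_m:
  assumes "x \<in> carrier Q" "y \<in> carrier Q" "z \<in> carrier Q" "w \<in> carrier Q"
  shows "associator x y (z \<otimes> w) = conj_by (associator x y z) w \<otimes> associator x y w"
proof -
  have a: "associator x y z \<in> nuc" "associator x y w \<in> nuc" "associator x y (z \<otimes> w) \<in> nuc"
    using assms by simp_all
  have c: "conj_by (associator x y z) w \<in> nuc" "w \<otimes> conj_by (associator x y z) w = associator x y z \<otimes> w"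
    using a assms by (simp_all add: m_conj_by)
  have "(z \<otimes> w) \<otimes> associator x y (z \<otimes> w) = (z \<otimes> associator x y z) \<otimes> (w \<otimes> associator x y w)"
    using LM_fixing_one_hom[OF left_inner[OF assms(1,2)] assms(3,4)] assms
    by (simp add: left_inner_associator(2))
  also have "\<dots> = z \<otimes> ((associator x y z \<otimes> w) \<otimes> associator x y w)"
    using a assms by (simp add: nuc_assoc)
  also have "\<dots> = z \<otimes> ((w \<otimes> conj_by (associator x y z) w) \<otimes> associator x y w)"
    using c by simp
  also have "\<dots> = (z \<otimes> w) \<otimes> (conj_by (associator x y z) w \<otimes> associator x y w)"
    using a c(1) assms by (simp add: nuc_assoc)
  finally show ?thesis
    using assms a c(1) by simp
qed

lemma associator_nuc: "\<lbrakk>x \<in> carrier Q; y \<in> carrier Q; n \<in> nuc\<rbrakk> \<Longrightarrow> associator x y n = \<one>"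
  by (simp add: associator_eq_one_iff nuc_assoc)

text \<open>Exchanging \<open>y\<close> and \<open>z\<close> changes \<open>y \<otimes> z\<close> by
  a nuclear \<open>n\<close>. By \<open>rcc\<close> the product
  \<open>(x \<otimes> y) \<otimes> z\<close> changes by the same \<open>n\<close>, which commutes
  with the associator.\<close>

lemma associator_swap_right:
  assumes "x \<in> carrier Q" "y \<in> carrier Q" "z \<in> carrier Q"
  shows "associator x y z = associator x z y"
proof -
  obtain n where n: "n \<in> nuc" "y \<otimes> z = (z \<otimes> y) \<otimes> n"
    using commutator_nuc assms by blast
  have yz: "y \<otimes> z = z \<otimes> (y \<otimes> n)"
    using n assms by (simp add: nuc_assoc)
  have a: "associator x z y \<in> nuc_center"
    using assms by simp
  have 1: "(x \<otimes> y) \<otimes> z = ((x \<otimes> z) \<otimes> y) \<otimes> n"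
    using rcc[of z y x] n assms by (simp add: yz nuc_assoc)
  have "x \<otimes> (y \<otimes> z) = (x \<otimes> (z \<otimes> y)) \<otimes> n"
    using n assms by (simp add: nuc_assoc)
  also have "\<dots> = ((x \<otimes> z) \<otimes> y) \<otimes> (associator x z y \<otimes> n)"
    using m_associator[of x z y] n a assms by (metis m_closed nuc_assoc(3) nuc_closed nuc_center_closed)
  also have "\<dots> = ((x \<otimes> y) \<otimes> z) \<otimes> associator x z y"
    unfolding 1 nuc_center_commute[OF a n(1)]
    using n a assms by (metis m_closed nuc_assoc(2) nuc_closed nuc_center_closed)
  finally show ?thesis
    using assms a by (intro associator_eqI) auto
qed

text \<open>The dual argument from \<open>lcc\<close>, with the commutator factor on the
  left.\<close>

lemma associator_swap_left:
  assumes "x \<in> carrier Q" "y \<in> carrier Q" "z \<in> carrier Q"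
  shows "associator x y z = associator y x z"
proof -
  obtain m where m: "m \<in> nuc" "x \<otimes> y = (y \<otimes> x) \<otimes> m"
    using commutator_nuc assms by blast
  \<comment> \<open>This carries \<open>m\<close> from the right of \<open>y \<otimes> x\<close> to
    its left.\<close>
  define n where "n = rdiv Q ((y \<otimes> x) \<otimes> m) (y \<otimes> x)"
  have n: "n \<in> nuc" "n \<otimes> (y \<otimes> x) = x \<otimes> y"
    using m assms by (simp_all add: n_def nuc_conj)
  have a: "associator y x z \<in> nuc_center"
    using assms by simp
  have "rdiv Q (x \<otimes> y) x = n \<otimes> y"
    using n assms by (metis m_closed m_rdiv nuc_assoc(1) nuc_closed)
  then have "x \<otimes> (y \<otimes> z) = (n \<otimes> y) \<otimes> (x \<otimes> z)"
    using lcc[OF assms] by simp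
  also have "\<dots> = n \<otimes> (y \<otimes> (x \<otimes> z))"
    using n(1) assms by (simp add: nuc_assoc)
  also have "\<dots> = n \<otimes> (((y \<otimes> x) \<otimes> z) \<otimes> associator y x z)"
    by (simp only: m_associator[OF assms(2,1,3)])
  also have "\<dots> = ((n \<otimes> (y \<otimes> x)) \<otimes> z) \<otimes> associator y x z"
    using n(1) a assms by (metis m_closed nuc_assoc(1) nuc_center_closed)
  finally show ?thesis
    unfolding n(2) using assms a by (intro associator_eqI) auto
qed

text \<open>\<open>z \<otimes> w\<close> and \<open>w \<otimes> z\<close> differ by a nuclear
  factor, which does not affect associators; both are expanded by
  \<open>associator_m\<close>.\<close>

lemma associator_exchange:
  assumes "x \<in> carrier Q" "y \<in> carrier Q" "z \<in> carrier Q" "w \<in> carrier Q"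
  shows "conj_by (associator x y z) w \<otimes> associator x y w = conj_by (associator x y w) z \<otimes> associator x y z"
proof -
  obtain n where n: "n \<in> nuc" "z \<otimes> w = (w \<otimes> z) \<otimes> n"
    using commutator_nuc assms by blast
  have "associator x y (z \<otimes> w) = associator x y (w \<otimes> z)"
    using n assms by (simp add: associator_m[of x y "w \<otimes> z" n] associator_nuc conj_by_nuc_trivial)
  then show ?thesis
    using assms by (simp add: associator_m)
qed

text \<open>The WIP condition says that \<open>x\<close>, \<open>c\<close> and \<open>t\<close>
  associate. As \<open>(x \<otimes> c) \<otimes> t = \<one>\<close> also associates with
  \<open>x\<close> and \<open>c\<close>, so does \<open>x \<otimes> c\<close>.\<close>

lemma WIP_associator:
  assumes "WIP_elem Q c" "c \<in> carrier Q" "x \<in> carrier Q"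
  shows "associator x c (x \<otimes> c) = \<one>"
proof -
  define t where "t = ldiv Q (x \<otimes> c) \<one>"
  have t: "t \<in> carrier Q" "(x \<otimes> c) \<otimes> t = \<one>"
    using assms by (simp_all add: t_def)
  have "c \<otimes> t = ldiv Q x \<one>"
    using assms by (simp add: WIP_elem_def t_def)
  then have "associator x c t = \<one>"
    using t assms by (simp add: associator_eq_one_iff)
  then have "conj_by (associator x c (x \<otimes> c)) t = \<one>"
    using associator_m[of x c "x \<otimes> c" t] t assms by (simp add: associator_nuc)
  then show ?thesis
    using conj_by_eq_one[of "associator x c (x \<otimes> c)" t] assms t by simp
qed

section \<open>From trivial associators of generators to groups\<close>

text \<open>By \<open>associator_m\<close>, \<open>associator x y\<close> is a crossed homomorphism
  into \<open>nuc_center\<close>; this set is its kernel.\<close>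

lemma subloop_associator_trivial:
  assumes "x \<in> carrier Q" "y \<in> carrier Q"
  shows "subloop {z \<in> carrier Q. associator x y z = \<one>} Q"
  unfolding subloop_def
proof (intro conjI ballI)
  fix z w
  assume "z \<in> {z \<in> carrier Q. associator x y z = \<one>}" "w \<in> {z \<in> carrier Q. associator x y z = \<one>}"
  then have zw: "z \<in> carrier Q" "w \<in> carrier Q" "associator x y z = \<one>" "associator x y w = \<one>"
    by auto
  then show "z \<otimes> w \<in> {z \<in> carrier Q. associator x y z = \<one>}"
    using assms by (simp add: associator_m)
  show "ldiv Q z w \<in> {z \<in> carrier Q. associator x y z = \<one>}"
    using associator_m[of x y z "ldiv Q z w"] zw assms by simp
  show "rdiv Q w z \<in> {z \<in> carrier Q. associator x y z = \<one>}"
    using associator_m[of x y "rdiv Q w z" z] zw assms conj_by_eq_one[of "associator x y (rdiv Q w z)" z] by simp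
qed (use assms in \<open>auto simp: associator_nuc\<close>)

lemma subloop_generated_subset: "\<lbrakk>subloop H Q; S \<subseteq> H\<rbrakk> \<Longrightarrow> subloop_generated Q S \<subseteq> H"
  unfolding subloop_generated_def by blast

text \<open>The kernel argument treats the last place only. Symmetry rotates the other arguments
  there, so they pass from \<open>S\<close> to the generated subloop one at a time.\<close>

lemma associator_trivial_generated:
  assumes "S \<subseteq> carrier Q" and "\<And>x y z. \<lbrakk>x \<in> S; y \<in> S; z \<in> S\<rbrakk> \<Longrightarrow> associator x y z = \<one>"
    and "x \<in> subloop_generated Q S" "y \<in> subloop_generated Q S" "z \<in> subloop_generated Q S"
  shows "associator x y z = \<one>"
proof -
  let ?H = "subloop_generated Q S"
  have H: "?H \<subseteq> carrier Q"
    using subloop_generated(1)[OF assms(1)] by (simp add: subloop_def)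
  have gen: "associator x y z = \<one>"
    if "x \<in> carrier Q" "y \<in> carrier Q" "z \<in> ?H" "\<And>s. s \<in> S \<Longrightarrow> associator x y s = \<one>" for x y z
    using subloop_generated_subset[OF subloop_associator_trivial[OF that(1,2)], of S] that(3,4) assms(1)
    by blast
  have 1: "associator x y z = \<one>" if "x \<in> S" "y \<in> S" "z \<in> ?H" for x y z
    using gen[of x y z] that assms(1,2) by blast
  have 2: "associator x y z = \<one>" if "x \<in> S" "y \<in> ?H" "z \<in> ?H" for x y z
  proof (rule gen)
    fix s assume "s \<in> S"
    then show "associator x y s = \<one>"
      using 1[of x s y] associator_swap_right[of x y s] that H assms(1) by (metis subsetD)
  qed (use that H assms(1) in auto)
  show ?thesis
  proof (rule gen)
    fix s assume s: "s \<in> S"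
    have "x \<in> carrier Q" "y \<in> carrier Q" "s \<in> carrier Q"
      using assms s H by auto
    then show "associator x y s = \<one>"
      using 2[OF s, of x y] s assms(3,4) by (metis associator_swap_left associator_swap_right)
  qed (use assms H in auto)
qed

lemma subloop_groupI:
  assumes H: "subloop H Q"
    and "\<And>x y z. \<lbrakk>x \<in> H; y \<in> H; z \<in> H\<rbrakk> \<Longrightarrow> (x \<otimes> y) \<otimes> z = x \<otimes> (y \<otimes> z)"
  shows "group (Q\<lparr>carrier := H\<rparr>)"
proof (rule groupI)
  have HQ: "H \<subseteq> carrier Q"
    using H by (simp add: subloop_def)
  fix x assume "x \<in> carrier (Q\<lparr>carrier := H\<rparr>)"
  then have "rdiv Q \<one> x \<in> H" "rdiv Q \<one> x \<otimes> x = \<one>"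
    using H HQ by (auto simp: subloop_def)
  then show "\<exists>y\<in>carrier (Q\<lparr>carrier := H\<rparr>). y \<otimes>\<^bsub>Q\<lparr>carrier := H\<rparr>\<^esub> x = \<one>\<^bsub>Q\<lparr>carrier := H\<rparr>\<^esub>"
    by auto
qed (use assms in \<open>auto simp: subloop_def\<close>)

lemma power_assoc_associator:
  assumes "power_assoc_elem Q a" "a \<in> carrier Q"
  shows "associator a a a = \<one>"
proof -
  interpret A: group "Q\<lparr>carrier := subloop_generated Q {a}\<rparr>"
    using assms(1) by (simp add: power_assoc_elem_def)
  have "a \<in> subloop_generated Q {a}"
    using subloop_generated(2)[of "{a}"] assms(2) by simp
  then show ?thesis
    using A.m_assoc[of a a a] assms(2) by (simp add: associator_eq_one_iff)
qed

section \<open>Computation with the associators of \<open>b\<close>, \<open>c\<close> and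
  \<open>b \<otimes> b\<close>\<close>

lemma square_WIP_group:
  assumes bc: "b \<in> carrier Q" "c \<in> carrier Q"
    and pb: "associator b b b = \<one>" and pc: "associator c c c = \<one>"
    and wip: "\<And>x. x \<in> carrier Q \<Longrightarrow> associator x c (x \<otimes> c) = \<one>"
  shows "group (Q\<lparr>carrier := subloop_generated Q {b \<otimes> b, c}\<rparr>)"
proof -
  define u v where "u = associator b b c" and "v = associator b c c"
  have uv: "u \<in> nuc_center" "v \<in> nuc_center"
    using bc by (simp_all add: u_def v_def)
  have u: "associator b b c = u" "associator b c b = u" "associator c b b = u"
    using bc associator_swap_right[of b c b] associator_swap_left[of c b b] by (simp_all add: u_def)
  have v: "associator b c c = v" "associator c b c = v" "associator c c b = v"
    using bc associator_swap_right[of c c b] associator_swap_left[of c b c] by (simp_all add: v_def)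
  \<comment> \<open>Compare the expansions of the associators of \<open>b\<close>, \<open>b\<close>
    with \<open>b \<otimes> c\<close> and with \<open>c \<otimes> b\<close>; \<open>pb\<close>
    removes the other factors.\<close>
  have ub: "conj_by u b = u"
    using associator_exchange[of b b b c] bc uv by (simp add: u pb)
  have vc: "conj_by v c = v"
    using associator_exchange[of c c c b] bc uv by (simp add: v pc)
  \<comment> \<open>The WIP condition at \<open>x = b\<close>. As \<open>c\<close> fixes
    \<open>v\<close>, the left side is \<open>conj_by (u \<otimes> v) c\<close>.\<close>
  have ucv: "conj_by u c \<otimes> v = \<one>"
    using wip[of b] bc by (simp add: associator_m u v)
  then have "conj_by (u \<otimes> v) c = \<one>"
    using bc uv vc by (simp add: conj_by_m)
  then have uv1: "u \<otimes> v = \<one>"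
    using conj_by_eq_one[of "u \<otimes> v" c] bc uv by simp
  \<comment> \<open>Preparation for the WIP condition at \<open>x = b \<otimes> c\<close>, whose
    associator expands to \<open>v \<otimes> v\<close> by these two values.\<close>
  have "associator (b \<otimes> c) c c = v"
    using associator_swap_left[of "b \<otimes> c" c c] associator_swap_right[of c "b \<otimes> c" c] bc uv
    by (simp add: associator_m v pc vc)
  moreover have "associator (b \<otimes> c) c b = \<one>"
    using associator_swap_right[of "b \<otimes> c" c b] associator_swap_left[of "b \<otimes> c" b c]
      associator_swap_right[of b "b \<otimes> c" c] bc ucv by (simp add: associator_m u v)
  ultimately have "v \<otimes> v = \<one>"
    using wip[of "b \<otimes> c"] bc uv by (simp add: associator_m vc)
  then have eq: "v = u" and sq: "u \<otimes> u = \<one>"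
    using uv1 uv r_cancel[of v u v] by auto
  let ?B = "b \<otimes> b"
  have B: "?B \<in> carrier Q"
    using bc by simp
  \<comment> \<open>As \<open>b\<close> fixes \<open>u = v\<close>, the first two associators reduce
    to \<open>u \<otimes> u\<close>.\<close>
  have B1: "associator c c ?B = \<one>" "associator b c ?B = \<one>" "associator b b ?B = \<one>"
    using bc by (simp_all add: associator_m u v eq ub sq pb)
  \<comment> \<open>From here on symmetry brings a remaining \<open>b\<close> to the last place,
    where \<open>associator_m\<close> replaces it by \<open>?B\<close>.\<close>
  have "associator ?B c b = \<one>"
    using B1(2) bc B by (metis associator_swap_left associator_swap_right)
  then have B2: "associator ?B c ?B = \<one>"
    using bc B by (simp add: associator_m)
  have "associator ?B b b = \<one>"
    using B1(3) bc B by (metis associator_swap_left associator_swap_right)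
  then have "associator ?B b ?B = \<one>"
    using bc B by (simp add: associator_m)
  then have "associator ?B ?B b = \<one>"
    using associator_swap_right[of ?B ?B b] bc B by simp
  then have B3: "associator ?B ?B ?B = \<one>"
    using bc B by (simp add: associator_m)
  have B': "associator ?B ?B c = \<one>" "associator c ?B ?B = \<one>" "associator ?B c c = \<one>" "associator c ?B c = \<one>"
    using B1(1) B2 bc B by (metis associator_swap_left associator_swap_right)+
  have S: "{?B, c} \<subseteq> carrier Q"
    using bc by simp
  have gen: "associator x y z = \<one>" if "x \<in> {?B, c}" "y \<in> {?B, c}" "z \<in> {?B, c}" for x y z
    using that B1(1) B2 B3 B' pc by auto
  have H: "subloop (subloop_generated Q {?B, c}) Q"
    using subloop_generated(1)[OF S] .
  show ?thesis
  proof (rule subloop_groupI[OF H])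
    fix x y z
    assume xyz: "x \<in> subloop_generated Q {?B, c}" "y \<in> subloop_generated Q {?B, c}"
      "z \<in> subloop_generated Q {?B, c}"
    have "associator x y z = \<one>"
      by (rule associator_trivial_generated[OF S gen xyz])
    moreover have "x \<in> carrier Q" "y \<in> carrier Q" "z \<in> carrier Q"
      using H xyz unfolding subloop_def by blast+
    ultimately show "(x \<otimes> y) \<otimes> z = x \<otimes> (y \<otimes> z)"
      by (simp add: associator_eq_one_iff)
  qed
qed

end

theorem theorem6p10:
  fixes Q :: "('a, 'm) monoid_scheme" (structure) and b c :: 'a
  assumes "cc_loop Q"
    and "b \<in> carrier Q" and "c \<in> carrier Q"
    and "power_assoc_elem Q b" and "power_assoc_elem Q c"
    and "WIP_elem Q c"
  shows "group (Q\<lparr>carrier := subloop_generated Q {b \<otimes> b, c}\<rparr>)"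
proof -
  interpret cc_loop Q by fact
  show ?thesis
    using assms power_assoc_associator WIP_associator by (intro square_WIP_group) auto
qed

end
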